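(* For all integers $k \ge 1$ and $\ell \ge 0$ there is a constant $C(k,\ell)$ (depending only on $k$ and $\ell$) such that the following holds for every $n$ and every convex polygon with $n$ vertices. Let $d_1 > d_2 > \dotsb$ be the distinct distances between pairs of vertices, and let $m_i$ be the number of (unordered) pairs of vertices at distance exactly $d_i$. If there exist two distinct vertices $a$ and $b$ such that there are at most $\ell$ vertices between $a$ and $b$ and $|ab| \ge d_k$, then $$m_{\le k} := \sum_{i=1}^{k} m_i \le n + C(k,\ell).$$
   Context: All vertices of a convex polygon are extreme points of it (the vertex set is in convex position). "There are at most $\ell$ vertices between $a$ and $b$" means that at least one of the two boundary arcs of the polygon joining $a$ to $b$ contains at most $\ell$ vertices of the polygon other than $a$ and $b$. The hypothesis $|ab| \ge d_k$ presupposes that the polygon determines at least $k$ distinct distances. *)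

theory Defs
  imports "HOL-Analysis.Analysis"
begin

definition convex_polygon :: "(real ^ 2) set \<Rightarrow> bool" where
  "convex_polygon P \<longleftrightarrow> polytope P \<and> aff_dim P = 2"

definition polygon_vertices :: "(real ^ 2) set \<Rightarrow> (real ^ 2) set" where
  "polygon_vertices P = {v. v extreme_point_of P}"

text \<open>For distinct points \<open>a\<close>, \<open>b\<close> of the boundary of a convex polygon there are, up to
  parametrisation, exactly two arcs in the boundary joining \<open>a\<close> to \<open>b\<close>.\<close>

definition boundary_arc :: "(real ^ 2) set \<Rightarrow> real ^ 2 \<Rightarrow> real ^ 2 \<Rightarrow> (real \<Rightarrow> real ^ 2) \<Rightarrow> bool" where
  "boundary_arc P a b g \<longleftrightarrow>
     arc g \<and> path_image g \<subseteq> frontier P \<and> pathstart g = a \<and> pathfinish g = b"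

definition at_most_between :: "(real ^ 2) set \<Rightarrow> nat \<Rightarrow> real ^ 2 \<Rightarrow> real ^ 2 \<Rightarrow> bool" where
  "at_most_between P l a b \<longleftrightarrow>
     (\<exists>g. boundary_arc P a b g \<and> card (polygon_vertices P \<inter> path_image g - {a, b}) \<le> l)"

definition distances :: "'a::metric_space set \<Rightarrow> real set" where
  "distances V = {dist u v | u v. u \<in> V \<and> v \<in> V \<and> u \<noteq> v}"

text \<open>The \<open>i\<close>-th largest distance, counted from \<open>i = 1\<close>. It is meaningful only for finite \<open>V\<close>
  and \<open>1 \<le> i \<le> card (distances V)\<close>.\<close>

definition nth_distance :: "'a::metric_space set \<Rightarrow> nat \<Rightarrow> real" where
  "nth_distance V i = rev (sorted_list_of_set (distances V)) ! (i - 1)"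

definition distance_mult :: "'a::metric_space set \<Rightarrow> nat \<Rightarrow> nat" where
  "distance_mult V i =
     card {{u, v} | u v. u \<in> V \<and> v \<in> V \<and> u \<noteq> v \<and> dist u v = nth_distance V i}"

end

theory Submission
  imports Defs
begin

text \<open>
  Call a pair of vertices long if its distance is at least \<open>d = d_k\<close>; the sum to be bounded counts the
  long pairs. The long pair \<open>ab\<close> with few vertices on one side forces all long pairs to meet a set of
  boundedly many vertices, and all but boundedly many of the other vertices form at most one long pair
  with a member of that set.

  \<^bold>\<open>The covering set.\<close> Let \<open>xy\<close> and \<open>ij\<close> be opposite sides of a convex quadrilateral \<open>x i j y\<close> of vertices, both
  long. A convex quadrilateral has an angle of at least \<open>\<pi>/2\<close> (\<open>quadrilateral_has_nonacute_angle\<close>). Moving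
  the end of the chord at that angle one vertex inwards, towards the other chord, makes the chord strictly
  longer (\<open>disjoint_chords_advance\<close>). A long chord can grow fewer than \<open>k\<close> times, because there are only
  \<open>k\<close> long distances, so the process soon ends, and it only ends when one of the two gaps between the
  chords is used up. Hence one gap had fewer than \<open>2k\<close> steps (\<open>disjoint_long_chords_close\<close>). Applied to
  \<open>ab\<close> and any other long pair, this says that the other pair has an end on the short side of \<open>ab\<close> or
  within \<open>2k\<close> steps of \<open>a\<close> or of \<open>b\<close>: these at most \<open>4k + l\<close> vertices form a set \<open>S\<close> that meets every
  long pair (\<open>small_cover_of_long_pairs\<close>).

  \<^bold>\<open>The count.\<close> If a vertex is at long distance from two distinct points \<open>p\<close>, \<open>q\<close> of \<open>S\<close>, it lies on one
  of at most \<open>k\<close> circles around \<open>p\<close> and on one of at most \<open>k\<close> circles around \<open>q\<close>, and two such circles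
  share at most two points. So only boundedly many vertices have two long partners in \<open>S\<close>; the other
  vertices outside \<open>S\<close> account for at most one long pair each, which gives \<open>n\<close>, and everything else is
  bounded (\<open>card_long_pairs_le\<close>).

  What remains is to read the hypothesis on boundary arcs combinatorially: an arc of the boundary from
  \<open>a\<close> to \<open>b\<close> cannot avoid a vertex on each side of the line \<open>ab\<close>, because the diagonal joining two such
  vertices separates \<open>a\<close> from \<open>b\<close> within the polygon (\<open>frontier_arc_meets_diagonal\<close>).
\<close>

section \<open>Orientation and convex position in the plane\<close>

text \<open>Twice the signed area of the triangle \<open>abc\<close>: positive for a counterclockwise turn.\<close>

definition orient :: "real ^ 2 \<Rightarrow> real ^ 2 \<Rightarrow> real ^ 2 \<Rightarrow> real" where
  "orient a b c = (b$1 - a$1) * (c$2 - a$2) - (b$2 - a$2) * (c$1 - a$1)"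

lemma orient_rotate: "orient b c a = orient a b c"
  by (simp add: orient_def algebra_simps)

lemma orient_flip: "orient b a c = - orient a b c"
  by (simp add: orient_def algebra_simps)

lemma orient_swap: "orient a c b = - orient a b c"
  by (simp add: orient_def algebra_simps)

lemma orient_degenerate [simp]: "orient a a b = 0" "orient a b a = 0" "orient a b b = 0"
  by (simp_all add: orient_def)

lemma vec2_eqI: "x $ 1 = y $ 1 \<Longrightarrow> x $ 2 = y $ 2 \<Longrightarrow> x = y" for x y :: "real ^ 2"
  by (simp add: vec_eq_iff forall_2)

lemma inner_vec2: "x \<bullet> y = x$1 * y$1 + x$2 * y$2" for x y :: "real ^ 2"
  by (simp add: inner_vec_def sum_2)

definition convex_position :: "(real ^ 2) set \<Rightarrow> bool" where
  "convex_position V \<longleftrightarrow> (\<forall>v\<in>V. v \<notin> convex hull (V - {v}))"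

text \<open>The usable form of convex position: no point is a weighted mean of three others. The
  differences \<open>x - v\<close> let the coefficients be arbitrary orientations, with no normalisation, and repeated
  points among \<open>x\<close>, \<open>y\<close>, \<open>z\<close> cover the case of two.\<close>

lemma convex_positionD:
  assumes "convex_position V" "v \<in> V" "{x, y, z} \<subseteq> V - {v}"
    and "0 \<le> \<alpha>" "0 \<le> \<beta>" "0 \<le> \<gamma>" "0 < \<alpha> + \<beta> + \<gamma>"
    and comb: "\<alpha> *\<^sub>R (x - v) + \<beta> *\<^sub>R (y - v) + \<gamma> *\<^sub>R (z - v) = 0"
  shows False
proof -
  define s where "s = \<alpha> + \<beta> + \<gamma>"
  have "s > 0" using assms by (simp add: s_def)
  have "s *\<^sub>R v = \<alpha> *\<^sub>R x + \<beta> *\<^sub>R y + \<gamma> *\<^sub>R z"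
    using comb by (simp add: s_def algebra_simps)
  then have "v = (1 / s) *\<^sub>R (\<alpha> *\<^sub>R x + \<beta> *\<^sub>R y + \<gamma> *\<^sub>R z)"
    using \<open>s > 0\<close> by (metis divide_self_if less_irrefl scaleR_one scaleR_scaleR times_divide_eq_left mult_1)
  also have "\<dots> = (\<alpha> / s) *\<^sub>R x + (\<beta> / s) *\<^sub>R y + (\<gamma> / s) *\<^sub>R z"
    by (simp add: scaleR_add_right)
  finally have "v = (\<alpha> / s) *\<^sub>R x + (\<beta> / s) *\<^sub>R y + (\<gamma> / s) *\<^sub>R z" .
  moreover have "\<alpha> / s + \<beta> / s + \<gamma> / s = 1"
    using \<open>s > 0\<close> by (simp add: s_def add_divide_distrib [symmetric])
  moreover have "0 \<le> \<alpha> / s" "0 \<le> \<beta> / s" "0 \<le> \<gamma> / s"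
    using \<open>s > 0\<close> assms by auto
  ultimately have "v \<in> convex hull {x, y, z}"
    unfolding convex_hull_3 by blast
  then have "v \<in> convex hull (V - {v})"
    using hull_mono [OF assms(3)] by blast
  then show False
    using assms(1,2) by (auto simp: convex_position_def)
qed

text \<open>Barycentric coordinates: \<open>v\<close> divides the triangle \<open>xyz\<close> into three triangles whose signed areas are
  its weights. If all three are nonnegative and not all are zero, \<open>v\<close> lies in the triangle.\<close>

lemma orient_relation:
  "orient v y z *\<^sub>R (x - v) + orient v z x *\<^sub>R (y - v) + orient v x y *\<^sub>R (z - v) = 0"
  by (rule vec2_eqI) (simp_all add: orient_def algebra_simps)

text \<open>Seen from a point \<open>v\<close> in convex position, all other points lie within an angle less than \<open>\<pi>\<close>, so
  turning counterclockwise about \<open>v\<close> never comes full circle. This makes the angular order transitive.\<close>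

lemma triangle_not_around_vertex:
  assumes V: "convex_position V" "v \<in> V" "x \<in> V" "y \<in> V" "z \<in> V" "v \<noteq> x" "v \<noteq> y" "v \<noteq> z"
    and "0 \<le> orient v x y" "0 \<le> orient v y z" "0 < orient v z x"
  shows False
  by (rule convex_positionD [OF V(1,2) _ _ _ _ _ orient_relation [of v y z x]])
     (use assms in auto)

text \<open>If \<open>x\<close>, \<open>y\<close>, \<open>z\<close> are met in this order when turning about \<open>a\<close> without a left turn at \<open>y\<close>, then \<open>y\<close>
  lies in the triangle \<open>axz\<close>.\<close>

lemma angular_order_imp_ccw:
  assumes V: "convex_position V" "a \<in> V" "x \<in> V" "y \<in> V" "z \<in> V" "y \<noteq> a" "y \<noteq> x" "y \<noteq> z"
    and "0 \<le> orient a x y" "0 \<le> orient a y z" "0 < orient a x z"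
  shows "0 < orient x y z"
proof (rule ccontr)
  assume "\<not> 0 < orient x y z"
  moreover have "orient y x z + orient y z a + orient y a x = orient a x z"
    by (simp add: orient_def algebra_simps)
  moreover have "orient y z a = orient a y z" "orient y a x = orient a x y" "orient y x z = - orient x y z"
    by (simp_all add: orient_def algebra_simps)
  ultimately show False
    by (intro convex_positionD [OF V(1) V(4) _ _ _ _ _ orient_relation [of y x z a]])
       (use assms in auto)
qed

lemma collinear_projection:
  assumes "orient x y z = 0"
  shows "((y - x) \<bullet> (z - x)) *\<^sub>R (y - x) = ((y - x) \<bullet> (y - x)) *\<^sub>R (z - x)"
proof (rule vec2_eqI)
  have "((y - x) \<bullet> (z - x)) * (y$1 - x$1) - ((y - x) \<bullet> (y - x)) * (z$1 - x$1) = (y$2 - x$2) * orient x y z"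
    unfolding orient_def inner_vec2 vector_minus_component by algebra
  then show "(((y - x) \<bullet> (z - x)) *\<^sub>R (y - x)) $ 1 = (((y - x) \<bullet> (y - x)) *\<^sub>R (z - x)) $ 1"
    using assms by simp
  have "((y - x) \<bullet> (z - x)) * (y$2 - x$2) - ((y - x) \<bullet> (y - x)) * (z$2 - x$2) = - (y$1 - x$1) * orient x y z"
    unfolding orient_def inner_vec2 vector_minus_component by algebra
  then show "(((y - x) \<bullet> (z - x)) *\<^sub>R (y - x)) $ 2 = (((y - x) \<bullet> (y - x)) *\<^sub>R (z - x)) $ 2"
    using assms by simp
qed

lemma no_three_collinear:
  assumes V: "convex_position V" "x \<in> V" "y \<in> V" "z \<in> V" "x \<noteq> y" "y \<noteq> z" "x \<noteq> z"
  shows "orient x y z \<noteq> 0"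
proof
  assume 0: "orient x y z = 0"
  \<comment> \<open>On the line through \<open>x\<close> and \<open>y\<close>, with \<open>x\<close> at 0 and \<open>y\<close> at 1, the point \<open>z\<close> sits at \<open>t / p\<close>; the three
    cases say which of the points is the middle one, and that point is not extreme.\<close>
  define t where "t = (y - x) \<bullet> (z - x)"
  define p where "p = (y - x) \<bullet> (y - x)"
  have "p > 0" using assms by (auto simp: p_def)
  have comm: "t *\<^sub>R (y - x) = p *\<^sub>R (z - x)"
    using collinear_projection [OF 0] by (simp add: t_def p_def)
  consider "t \<le> 0" | "0 < t" "t \<le> p" | "p \<le> t" "0 < t" by linarith
  then show False
  proof cases
    case 1
    show False
      by (rule convex_positionD [OF V(1,2), of y z z "-t" p 0])
         (use assms 1 \<open>p > 0\<close> comm in auto)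
  next
    case 2
    show False
      by (rule convex_positionD [OF V(1) V(4), of y x x t "p - t" 0])
         (use assms 2 \<open>p > 0\<close> comm in \<open>auto simp: algebra_simps\<close>)
  next
    case 3
    show False
      by (rule convex_positionD [OF V(1) V(3), of z x x p "t - p" 0])
         (use assms 3 \<open>p > 0\<close> comm in \<open>auto simp: algebra_simps\<close>)
  qed
qed

text \<open>If the line \<open>ab\<close> separates \<open>u\<close> from \<open>w\<close>, then the line \<open>uw\<close> separates \<open>a\<close> from \<open>b\<close>; otherwise one of
  \<open>a\<close>, \<open>b\<close> lies in the triangle formed by the other three points.\<close>

lemma diagonals_cross:
  assumes V: "convex_position V" "a \<in> V" "b \<in> V" "u \<in> V" "w \<in> V"
    and u: "0 < orient a b u" and w: "orient a b w < 0"
  shows "orient u w a < 0" and "0 < orient u w b"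
proof -
  have d: "a \<noteq> b" "a \<noteq> u" "a \<noteq> w" "b \<noteq> u" "b \<noteq> w"
    using u w by auto
  have r: "orient a w b = - orient a b w"
    "orient a u w = orient u w a"
    by (simp_all add: orient_def algebra_simps)
  show "orient u w a < 0"
  proof (rule ccontr)
    assume "\<not> orient u w a < 0"
    then show False
      by (intro convex_positionD [OF V(1,2) _ _ _ _ _ orient_relation [of a w b u]]; (unfold r)?)
         (use V d u w in auto)
  qed
  show "0 < orient u w b"
  proof (rule ccontr)
    assume "\<not> 0 < orient u w b"
    have comb: "orient a b u *\<^sub>R (w - b) + - orient a b w *\<^sub>R (u - b) + - orient u w b *\<^sub>R (a - b) = 0"
      by (rule vec2_eqI) (simp_all add: orient_def algebra_simps)
    show False
      by (rule convex_positionD [OF V(1,3) _ _ _ _ _ comb])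
         (use V d u w \<open>\<not> 0 < orient u w b\<close> in auto)
  qed
qed

section \<open>Boundary arcs of a convex polygon\<close>

lemma convex_position_extreme_points:
  assumes "convex P"
  shows "convex_position {v. v extreme_point_of P}"
proof -
  have False if v: "v extreme_point_of P" and h: "v \<in> convex hull ({v. v extreme_point_of P} - {v})" for v
  proof -
    have "convex hull ({v. v extreme_point_of P} - {v}) \<subseteq> P - {v}"
    proof (rule hull_minimal)
      show "{v. v extreme_point_of P} - {v} \<subseteq> P - {v}"
        by (auto simp: extreme_point_of_def)
      show "convex (P - {v})"
        using v assms by (simp add: extreme_point_of_stillconvex)
    qed
    with h show False by blast
  qed
  then show ?thesis by (auto simp: convex_position_def)
qed

lemma continuous_on_orient: "continuous_on S (\<lambda>x. orient a b x)"
  unfolding orient_def by (intro continuous_intros)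

lemma collinear_param:
  assumes "orient u w z = 0" "u \<noteq> w"
  obtains t where "z = u + t *\<^sub>R (w - u)"
proof -
  define p where "p = (w - u) \<bullet> (w - u)"
  have "p > 0" using assms by (auto simp: p_def)
  have "p *\<^sub>R (z - u) = ((w - u) \<bullet> (z - u)) *\<^sub>R (w - u)"
    using collinear_projection [OF assms(1)] by (simp add: p_def)
  then have "(1 / p) *\<^sub>R (p *\<^sub>R (z - u)) = (((w - u) \<bullet> (z - u)) / p) *\<^sub>R (w - u)"
    by simp
  then have "z = u + (((w - u) \<bullet> (z - u)) / p) *\<^sub>R (w - u)"
    using \<open>p > 0\<close> by (simp add: algebra_simps)
  then show thesis by (rule that)
qed

lemma frontier_supporting_line:
  fixes P :: "(real ^ 2) set"
  assumes "convex_polygon P" "z \<in> frontier P"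
  obtains c where "c \<noteq> 0" "\<And>y. y \<in> P \<Longrightarrow> c \<bullet> z \<le> c \<bullet> y"
proof -
  have "convex P" using assms by (simp add: convex_polygon_def polytope_imp_convex)
  have "closed P" using assms by (simp add: convex_polygon_def polytope_imp_closed)
  then have "z \<in> P" "z \<notin> interior P" 
    using assms(2) by (auto simp: frontier_def)
  have "affine hull P = UNIV"
    using assms(1) aff_dim_eq_full[of P] by (simp add: convex_polygon_def)
  then have "z \<notin> rel_interior P"
    using \<open>z \<notin> interior P\<close> by (simp add: rel_interior_interior)
  from supporting_hyperplane_rel_boundary [OF \<open>convex P\<close> \<open>z \<in> P\<close> this]
  show thesis using that by metis
qed

text \<open>The arc passes from one side of the line \<open>uw\<close> to the other, so it has a point \<open>z\<close> on that line. Within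
  the polygon the line is just the segment from \<open>u\<close> to \<open>w\<close>, since \<open>u\<close> and \<open>w\<close> are extreme. An inner
  point of that segment is not on the boundary: a supporting line there would contain \<open>u\<close> and \<open>w\<close>, yet
  \<open>a\<close> and \<open>b\<close> lie strictly on both sides of it. So \<open>z\<close> is \<open>u\<close> or \<open>w\<close>.\<close>

lemma frontier_arc_meets_diagonal:
  fixes P :: "(real ^ 2) set"
  assumes P: "convex_polygon P"
    and V: "a \<in> polygon_vertices P" "b \<in> polygon_vertices P" "u \<in> polygon_vertices P" "w \<in> polygon_vertices P"
    and u: "0 < orient a b u" and w: "orient a b w < 0"
    and g: "boundary_arc P a b g"
  shows "u \<in> path_image g \<or> w \<in> path_image g"
proof -
  let ?V = "polygon_vertices P"
  have "convex P" "closed P"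
    using P by (simp_all add: convex_polygon_def polytope_imp_convex polytope_imp_closed)
  then have cp: "convex_position ?V"
    unfolding polygon_vertices_def by (intro convex_position_extreme_points)
  note sa = diagonals_cross(1) [OF cp V u w] and sb = diagonals_cross(2) [OF cp V u w]
  have "u \<noteq> w" using u w by auto
  have inP: "x \<in> P" if "x \<in> ?V" for x
    using that by (auto simp: polygon_vertices_def extreme_point_of_def)
  have ext: "x \<notin> open_segment y z" if "x \<in> ?V" "y \<in> P" "z \<in> P" for x y z
    using that by (auto simp: polygon_vertices_def extreme_point_of_def)
  have img: "path_image g \<subseteq> frontier P" "a \<in> path_image g" "b \<in> path_image g" and "arc g"
    using g by (auto simp: boundary_arc_def)
  have "connected (orient u w ` path_image g)"
    using \<open>arc g\<close> by (intro connected_continuous_image continuous_on_orient connected_path_image arc_imp_path)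
  then have "{orient u w a .. orient u w b} \<subseteq> orient u w ` path_image g"
    using img by (intro connected_contains_Icc) auto
  moreover have "0 \<in> {orient u w a .. orient u w b}" using sa sb by simp
  ultimately obtain z where z: "z \<in> path_image g" "orient u w z = 0" by (auto simp: image_iff)
  then have "z \<in> frontier P" using img by blast
  then have "z \<in> P" using \<open>closed P\<close> by (auto simp: frontier_def)
  obtain t where t: "z = u + t *\<^sub>R (w - u)"
    using collinear_param [OF z(2) \<open>u \<noteq> w\<close>] .
  consider "t < 0" | "t = 0" | "0 < t" "t < 1" | "t = 1" | "1 < t" by linarith
  then show ?thesis
  proof cases
    case 1
    define s where "s = - t / (1 - t)"
    have "u = (1 - s) *\<^sub>R z + s *\<^sub>R w"
    proof -
      have e: "(1 - s) * t + s = 0" using 1 by (simp add: s_def field_simps)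
      have "(1 - s) *\<^sub>R z + s *\<^sub>R w = u + ((1 - s) * t + s) *\<^sub>R (w - u)"
        unfolding t by (simp add: algebra_simps)
      then show ?thesis using e by simp
    qed
    moreover have "0 < s" "s < 1" using 1 by (auto simp: s_def field_simps)
    moreover have "z \<noteq> w" using calculation \<open>u \<noteq> w\<close> by (auto simp: algebra_simps)
    ultimately have "u \<in> open_segment z w" by (auto simp: in_segment)
    then show ?thesis using ext [OF V(3) \<open>z \<in> P\<close> inP [OF V(4)]] by simp
  next
    case 5
    define s where "s = 1 / t"
    have "w = (1 - s) *\<^sub>R u + s *\<^sub>R z"
      using 5 unfolding t s_def by (simp add: algebra_simps)
    moreover have "0 < s" "s < 1" using 5 by (auto simp: s_def field_simps)
    moreover have "u \<noteq> z" using calculation \<open>u \<noteq> w\<close> by (auto simp: algebra_simps)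
    ultimately have "w \<in> open_segment u z" by (auto simp: in_segment)
    then show ?thesis using ext [OF V(4) inP [OF V(3)] \<open>z \<in> P\<close>] by simp
  next
    case 3
    obtain c where c: "c \<noteq> 0" "\<And>y. y \<in> P \<Longrightarrow> c \<bullet> z \<le> c \<bullet> y"
      using frontier_supporting_line [OF P \<open>z \<in> frontier P\<close>] by blast
    have cz: "c \<bullet> z = (1 - t) * (c \<bullet> u) + t * (c \<bullet> w)"
      unfolding t by (simp add: algebra_simps)
    have le: "c \<bullet> z \<le> c \<bullet> u" "c \<bullet> z \<le> c \<bullet> w" "c \<bullet> z \<le> c \<bullet> a" "c \<bullet> z \<le> c \<bullet> b"
      using c(2) inP V by auto
    have "(1 - t) * (c \<bullet> u - c \<bullet> z) + t * (c \<bullet> w - c \<bullet> z) = 0"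
      using cz by (simp add: algebra_simps)
    moreover have "0 \<le> (1 - t) * (c \<bullet> u - c \<bullet> z)" "0 \<le> t * (c \<bullet> w - c \<bullet> z)"
      using 3 le by auto
    ultimately have "(1 - t) * (c \<bullet> u - c \<bullet> z) = 0" "t * (c \<bullet> w - c \<bullet> z) = 0" by linarith+
    then have eq: "c \<bullet> u = c \<bullet> z" "c \<bullet> w = c \<bullet> z" using 3 by auto
    \<comment> \<open>The diagonals cross, so a positive combination of \<open>a\<close> and \<open>b\<close> lies on the line \<open>uw\<close>, where \<open>c\<close> is
      minimal on the polygon; hence \<open>c\<close> is minimal at \<open>a\<close> too.\<close>
    have rel: "orient u w b * (c \<bullet> a - c \<bullet> u) - orient u w a * (c \<bullet> b - c \<bullet> u)
        = orient u a b * (c \<bullet> w - c \<bullet> u)"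
      by (simp add: orient_def inner_vec2 algebra_simps)
    have "orient u w b * (c \<bullet> a - c \<bullet> u) + (- orient u w a) * (c \<bullet> b - c \<bullet> u) = 0"
      using rel eq by simp
    moreover have "0 \<le> orient u w b * (c \<bullet> a - c \<bullet> u)" "0 \<le> (- orient u w a) * (c \<bullet> b - c \<bullet> u)"
      using sa sb le eq by (auto intro!: mult_nonneg_nonneg mult_nonpos_nonneg)
    ultimately have "orient u w b * (c \<bullet> a - c \<bullet> u) = 0" by linarith
    then have ca: "c \<bullet> (a - u) = 0" using sb by (simp add: inner_diff_right)
    have cw: "c \<bullet> (w - u) = 0" using eq by (simp add: inner_diff_right)
    \<comment> \<open>Thus \<open>c\<close> is orthogonal to the two linearly independent vectors \<open>a - u\<close> and \<open>w - u\<close>.\<close>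
    have "orient u w a * c$1 = 0" "orient u w a * c$2 = 0"
      using ca cw by (auto simp: orient_def inner_vec2; algebra)+
    then have "c = 0" using sa by (intro vec2_eqI) auto
    then show ?thesis using c(1) by simp
  qed (use t z in auto)
qed

lemma at_most_between_imp_few_on_side:
  assumes P: "convex_polygon P" and V: "a \<in> polygon_vertices P" "b \<in> polygon_vertices P"
    and l: "at_most_between P l a b"
  shows "card {x \<in> polygon_vertices P. 0 < orient a b x} \<le> l \<or>
         card {x \<in> polygon_vertices P. orient a b x < 0} \<le> l"
proof -
  let ?V = "polygon_vertices P"
  obtain g where g: "boundary_arc P a b g" and c: "card (?V \<inter> path_image g - {a, b}) \<le> l"
    using l by (auto simp: at_most_between_def)
  have "finite ?V"
    using P by (simp add: polygon_vertices_def convex_polygon_def finite_polyhedron_extreme_points polytope_imp_polyhedron)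
  then have sub: "card A \<le> l" if "A \<subseteq> ?V \<inter> path_image g - {a, b}" for A
    using c card_mono [OF _ that] by (meson finite_Diff finite_Int le_trans)
  consider "\<forall>x\<in>?V. 0 < orient a b x \<longrightarrow> x \<in> path_image g" 
    | "\<forall>x\<in>?V. orient a b x < 0 \<longrightarrow> x \<in> path_image g"
    using frontier_arc_meets_diagonal [OF P V _ _ _ _ g] by blast
  then show ?thesis
  proof cases
    case 1 
    then have "card {x \<in> ?V. 0 < orient a b x} \<le> l" by (intro sub) auto
    then show ?thesis ..
  next
    case 2
    then have "card {x \<in> ?V. orient a b x < 0} \<le> l" by (intro sub) auto
    then show ?thesis ..
  qed
qed

section \<open>Vertices in cyclic order\<close>

definition convex_chain :: "(nat \<Rightarrow> real ^ 2) \<Rightarrow> nat \<Rightarrow> bool" where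
  "convex_chain u n \<longleftrightarrow> (\<forall>i j k. i < j \<and> j < k \<and> k < n \<longrightarrow> 0 < orient (u i) (u j) (u k))"

text \<open>The vertices are sorted by angle around \<open>b\<close>, the rank \<open>r\<close> of a point being the number of points before
  it; \<open>u\<close> is the inverse of \<open>r\<close>. The starting point is prescribed so that the arc facing a chord at \<open>b\<close>
  becomes an interval of indices without wrapping around.\<close>

lemma convex_position_enumeration:
  assumes "finite V" and cp: "convex_position V" and b: "b \<in> V"
  obtains u where "bij_betw u {..<card V} V" "u 0 = b" "convex_chain u (card V)"
proof -
  define pred where "pred x = {y \<in> V. 0 < orient b y x}" for x
  define r where "r x = (if x = b then 0 else Suc (card (pred x)))" for x
  have tri: "orient b x y \<noteq> 0" if "x \<in> V" "y \<in> V" "x \<noteq> b" "y \<noteq> b" "x \<noteq> y" for x y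
    using no_three_collinear [OF cp b] that by metis
  have trans: "0 < orient b x z" if "x \<in> V" "y \<in> V" "z \<in> V" "0 < orient b x y" "0 < orient b y z" for x y z
  proof (rule ccontr)
    assume n: "\<not> 0 < orient b x z"
    have d: "b \<noteq> x" "b \<noteq> y" "b \<noteq> z" using that by auto
    have "x \<noteq> z" using that orient_swap [of b x y] by auto
    then have "orient b x z \<noteq> 0" using tri that d by blast
    then have "0 < orient b z x" using n by (simp add: orient_swap [of b z x])
    then show False
      using triangle_not_around_vertex [OF cp b, of x y z] that d by auto
  qed
  have mono: "r x < r y" if "x \<in> V" "y \<in> V" "0 < orient b x y" for x y
  proof -
    have "x \<noteq> b" "y \<noteq> b" using that by auto
    have "pred x \<subseteq> pred y" "x \<in> pred y" "x \<notin> pred x"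
      using trans that by (auto simp: pred_def)
    then have "pred x \<subset> pred y" by blast
    then have "card (pred x) < card (pred y)"
      using assms(1) by (intro psubset_card_mono) (auto simp: pred_def)
    then show ?thesis using \<open>x \<noteq> b\<close> \<open>y \<noteq> b\<close> by (simp add: r_def)
  qed
  have less_imp: "0 < orient b x y" if "x \<in> V" "y \<in> V" "x \<noteq> b" "r x < r y" for x y
  proof (rule ccontr)
    assume n: "\<not> 0 < orient b x y"
    have "y \<noteq> b" "x \<noteq> y" using that by (auto simp: r_def)
    then have "0 < orient b y x" using tri that n by (metis linorder_neqE_linordered_idom orient_swap neg_0_less_iff_less)
    then show False using mono that by (meson less_asym)
  qed
  have inj: "inj_on r V"
  proof (rule inj_onI, rule ccontr)
    fix x y assume xy: "x \<in> V" "y \<in> V" "r x = r y" "x \<noteq> y"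
    then have "x \<noteq> b" "y \<noteq> b" by (auto simp: r_def split: if_splits)
    then have "0 < orient b x y \<or> 0 < orient b y x"
      using tri xy by (metis linorder_neqE_linordered_idom orient_swap neg_0_less_iff_less)
    then show False using mono xy by fastforce
  qed
  have lt: "r x < card V" if "x \<in> V" for x
  proof (cases "x = b")
    case True
    then show ?thesis using assms by (auto simp: r_def card_gt_0_iff)
  next
    case False
    have "card (pred x) \<le> card (V - {b, x})"
      using assms(1) by (intro card_mono) (auto simp: pred_def)
    also have "card (V - {b, x}) = card V - 2"
      using False that b assms(1) by (simp add: card_Diff_subset)
    finally have "card (pred x) \<le> card V - 2" .
    moreover have "2 \<le> card V"
      using card_mono [OF assms(1), of "{b, x}"] that b False by simp
    ultimately show ?thesis using False by (simp add: r_def)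
  qed
  have "r ` V = {..<card V}"
    using lt by (intro card_subset_eq) (auto simp: card_image inj)
  with inj have bij: "bij_betw r V {..<card V}" by (simp add: bij_betw_def)
  define u where "u = inv_into V r"
  have u: "u i \<in> V" "r (u i) = i" if "i < card V" for i
    using bij_betw_apply [OF bij_betw_inv_into [OF bij]] bij_betw_inv_into_right [OF bij] that
    by (auto simp: u_def)
  have "0 < card V" using lt [OF b] by simp
  then have u0: "u 0 = b"
    using u [of 0] by (auto simp: r_def split: if_splits)
  have "0 < orient (u i) (u j) (u k)" if "i < j" "j < k" "k < card V" for i j k
  proof -
    have V: "u i \<in> V" "u j \<in> V" "u k \<in> V" "r (u i) = i" "r (u j) = j" "r (u k) = k"
      using u that by auto
    have "u j \<noteq> b" "u k \<noteq> b" using V that by (auto simp: r_def)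
    have jk: "0 < orient b (u j) (u k)" using less_imp V that \<open>u j \<noteq> b\<close> by auto
    show ?thesis
    proof (cases "u i = b")
      case True
      then show ?thesis using jk by simp
    next
      case False
      then have ij: "0 < orient b (u i) (u j)" using less_imp V that by auto
      have "0 < orient b (u i) (u k)" using trans ij jk V by blast
      moreover have "u j \<noteq> u i" "u j \<noteq> u k" using V that by auto
      ultimately show ?thesis
        using angular_order_imp_ccw [OF cp b V(1-3) \<open>u j \<noteq> b\<close>] ij jk by simp
    qed
  qed
  then show thesis
    using bij_betw_inv_into [OF bij] u0 by (intro that [of u]) (auto simp: u_def convex_chain_def)
qed

section \<open>Disjoint long chords\<close>

text \<open>An angle sum argument by signs: if all angles were acute, then any two successive turns of the
  boundary would add up to an angle strictly between \<open>\<pi>\<close> and \<open>2\<pi>\<close>. So the direction \<open>CD\<close> would lie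
  clockwise of \<open>AB\<close>, and, going round the other half, \<open>AB\<close> clockwise of \<open>CD\<close>.\<close>

lemma quadrilateral_has_nonacute_angle:
  assumes "0 < orient A B C" "0 < orient B C D" "0 < orient C D A" "0 < orient D A B"
  shows "(B - A) \<bullet> (D - A) \<le> 0 \<or> (A - B) \<bullet> (C - B) \<le> 0 \<or> (B - C) \<bullet> (D - C) \<le> 0 \<or> (C - D) \<bullet> (A - D) \<le> 0"
proof (rule ccontr)
  assume "\<not> ?thesis"
  then have acute: "0 < (B - A) \<bullet> (D - A)" "0 < (A - B) \<bullet> (C - B)" "0 < (B - C) \<bullet> (D - C)" "0 < (C - D) \<bullet> (A - D)"
    by auto
  \<comment> \<open>The cross product of the directions \<open>AB\<close> and \<open>CD\<close>; each half of the boundary determines its sign.\<close>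
  define cr where "cr = (B$1 - A$1) * (D$2 - C$2) - (B$2 - A$2) * (D$1 - C$1)"
  have "cr * ((C - B) \<bullet> (C - B)) = - (orient A B C * ((B - C) \<bullet> (D - C)) + (A - B) \<bullet> (C - B) * orient B C D)"
    unfolding cr_def orient_def inner_vec2 vector_minus_component by algebra
  also have "\<dots> < 0" using assms acute by (simp only: neg_less_0_iff_less) (intro add_pos_pos mult_pos_pos)
  finally have "cr < 0" by (metis inner_ge_zero mult_nonneg_nonneg not_le)
  have "- cr * ((A - D) \<bullet> (A - D)) = - (orient C D A * ((B - A) \<bullet> (D - A)) + (C - D) \<bullet> (A - D) * orient D A B)"
    unfolding cr_def orient_def inner_vec2 vector_minus_component by algebra
  also have "\<dots> < 0" using assms acute by (simp only: neg_less_0_iff_less) (intro add_pos_pos mult_pos_pos)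
  finally have "0 < cr" by (metis inner_ge_zero mult_nonneg_nonneg not_le neg_0_le_iff_le)
  with \<open>cr < 0\<close> show False by simp
qed

text \<open>Since \<open>B\<close> lies in the angle \<open>PAD\<close>, the angle at \<open>A\<close> is at least as large for \<open>P\<close> as for \<open>B\<close>, so \<open>PD\<close>
  is opposite to a nonacute angle of the triangle \<open>PAD\<close>. The factor \<open>s\<close> covers both orientations at once.\<close>

lemma dist_increases_at_nonacute_angle:
  assumes B: "(B - A) \<bullet> (D - A) \<le> 0"
    and o: "0 < s * orient A P D" "0 \<le> s * orient A P B" "0 < s * orient A B D"
  shows "dist A D < dist P D"
proof -
  have "(s * orient A B D) * ((P - A) \<bullet> (D - A))
      = (s * orient A P D) * ((B - A) \<bullet> (D - A)) - (s * orient A P B) * ((D - A) \<bullet> (D - A))"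
    unfolding orient_def inner_vec2 vector_minus_component by algebra
  also have "\<dots> \<le> 0"
    using o B mult_nonneg_nonneg [OF o(2) inner_ge_zero [of "D - A"]] mult_nonneg_nonpos [of "s * orient A P D" "(B - A) \<bullet> (D - A)"] by linarith
  finally have "(P - A) \<bullet> (D - A) \<le> 0" using o(3) by (metis mult_pos_pos not_le)
  moreover have "P \<noteq> A" using o(1) by auto
  then have "0 < (P - A) \<bullet> (P - A)" by simp
  moreover have "(P - D) \<bullet> (P - D) = (P - A) \<bullet> (P - A) + (A - D) \<bullet> (A - D) - 2 * ((P - A) \<bullet> (D - A))"
    by (simp add: algebra_simps inner_commute)
  ultimately have "(A - D) \<bullet> (A - D) < (P - D) \<bullet> (P - D)" by linarith
  then show ?thesis by (simp add: dist_norm norm_lt)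
qed

text \<open>In the quadrilateral \<open>u x\<close>, \<open>u i\<close>, \<open>u j\<close>, \<open>u y\<close> with opposite sides \<open>xy\<close> and \<open>ij\<close>, the four cases
  correspond to the vertex with the nonacute angle, which moves one step towards the other chord.\<close>

lemma disjoint_chords_advance:
  assumes u: "convex_chain u n" and ord: "x < i" "i < j" "j < y" "y < n"
  shows "dist (u x) (u y) < dist (u (x + 1)) (u y) \<or> dist (u x) (u y) < dist (u x) (u (y - 1)) \<or>
         dist (u i) (u j) < dist (u (i - 1)) (u j) \<or> dist (u i) (u j) < dist (u i) (u (j + 1))"
proof -
  have pos: "0 < orient (u p) (u q) (u r)" if "p < q" "q < r" "r < n" for p q r
    using u that by (auto simp: convex_chain_def)
  have nonneg: "0 \<le> orient (u p) (u q) (u r)" if "p \<le> q" "q \<le> r" "r < n" for p q r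
    using pos [of p q r] that by (cases "p = q"; cases "q = r") auto
  have rev: "-1 * orient c b a = orient a b c" "-1 * orient b a c = orient a b c" for c b a
    by (simp_all add: orient_def algebra_simps)
  consider "(u i - u x) \<bullet> (u y - u x) \<le> 0" | "(u x - u i) \<bullet> (u j - u i) \<le> 0"
    | "(u i - u j) \<bullet> (u y - u j) \<le> 0" | "(u j - u y) \<bullet> (u x - u y) \<le> 0"
  proof -
    have "0 < orient (u x) (u i) (u j)" "0 < orient (u i) (u j) (u y)"
      using ord by (auto intro: pos)
    moreover have "0 < orient (u j) (u y) (u x)" "0 < orient (u y) (u x) (u i)"
      using ord pos [of x j y] pos [of x i y] orient_rotate [of "u j" "u y" "u x"]
        orient_rotate [of "u i" "u y" "u x"] orient_rotate [of "u y" "u x" "u i"] by auto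
    ultimately show thesis
      using quadrilateral_has_nonacute_angle that by blast
  qed
  then show ?thesis
  proof cases
    case 1
    have "dist (u x) (u y) < dist (u (x + 1)) (u y)"
      by (rule dist_increases_at_nonacute_angle [OF 1, of 1]) (use ord in \<open>auto intro: pos nonneg\<close>)
    then show ?thesis by blast
  next
    case 2
    have "dist (u i) (u j) < dist (u (i - 1)) (u j)"
      by (rule dist_increases_at_nonacute_angle [OF 2, of "-1"])
         (use ord pos [of "i - 1" i j] nonneg [of x "i - 1" i] pos [of x i j]
           rev(2) [of "u i" "u (i - 1)" "u j"] rev(1) [of "u i" "u (i - 1)" "u x"]
           rev(2) [of "u i" "u x" "u j"] in auto)
    then show ?thesis by blast
  next
    case 3
    then have 3: "(u y - u j) \<bullet> (u i - u j) \<le> 0" by (simp add: inner_commute)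
    have "dist (u j) (u i) < dist (u (j + 1)) (u i)"
      by (rule dist_increases_at_nonacute_angle [OF 3, of 1])
         (use ord pos [of i j "j+1"] pos [of i j y] nonneg [of j "j + 1" y]
           orient_rotate [of "u j" "u (j + 1)" "u i"] orient_rotate [of "u j" "u y" "u i"] in auto)
    then show ?thesis by (simp add: dist_commute)
  next
    case 4
    have "dist (u y) (u x) < dist (u (y - 1)) (u x)"
      by (rule dist_increases_at_nonacute_angle [OF 4, of "-1"]; unfold rev)
         (use ord in \<open>auto intro!: pos nonneg\<close>)
    then show ?thesis by (simp add: dist_commute)
  qed
qed

text \<open>The number of elements of \<open>K\<close> above a length bounds how often a chord can still grow. Each advance
  shortens one of the gaps \<open>i - x\<close> and \<open>y - j\<close> by one, but lowers the sum of the two numbers by at least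
  one, so if both gaps exceed that sum they always will. An advance would then always be possible, which
  cannot be.\<close>

lemma disjoint_long_chords_close:
  fixes K :: "real set"
  assumes u: "convex_chain u n" and K: "finite K"
    and long: "\<And>p q. p < q \<Longrightarrow> q < n \<Longrightarrow> d \<le> dist (u p) (u q) \<Longrightarrow> dist (u p) (u q) \<in> K"
    and "i < j" "y < n" "d \<le> dist (u x) (u y)" "d \<le> dist (u i) (u j)"
    and "card {t \<in> K. dist (u x) (u y) < t} + card {t \<in> K. dist (u i) (u j) < t} < i - x"
  shows "y - j \<le> card {t \<in> K. dist (u x) (u y) < t} + card {t \<in> K. dist (u i) (u j) < t}"
proof -
  define above where "above t = card {s \<in> K. t < s}" for t
  have dec: "above t' < above t" if "t < t'" "t' \<in> K" for t t'
    unfolding above_def using K that by (intro psubset_card_mono) auto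
  have "above (dist (u x) (u y)) + above (dist (u i) (u j)) < i - x \<Longrightarrow>
      y - j \<le> above (dist (u x) (u y)) + above (dist (u i) (u j))"
    if "i < j" "y < n" "d \<le> dist (u x) (u y)" "d \<le> dist (u i) (u j)"
    using that
  proof (induction "above (dist (u x) (u y)) + above (dist (u i) (u j))" arbitrary: x y i j rule: less_induct)
    case less
    show ?case
    proof (rule ccontr)
      assume far: "\<not> ?case"
      let ?L = "above (dist (u x) (u y)) + above (dist (u i) (u j))"
      have ord: "x < i" "i < j" "j < y" "y < n" using less.prems far by auto
      have Lx: "?L < i - x" and Ly: "?L < y - j" using less.prems far by auto
      consider "dist (u x) (u y) < dist (u (x + 1)) (u y)" | "dist (u x) (u y) < dist (u x) (u (y - 1))"
        | "dist (u i) (u j) < dist (u (i - 1)) (u j)" | "dist (u i) (u j) < dist (u i) (u (j + 1))"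
        using disjoint_chords_advance [OF u ord] by blast
      then show False
      proof cases
        case 1
        then have "above (dist (u (x + 1)) (u y)) < above (dist (u x) (u y))"
          using ord less.prems by (intro dec long) auto
        then show False
          using less.hyps [where x = "x + 1" and y = y and i = i and j = j] ord less.prems 1 Lx Ly by force
      next
        case 2
        then have "above (dist (u x) (u (y - 1))) < above (dist (u x) (u y))"
          using ord less.prems by (intro dec long) auto
        then show False
          using less.hyps [where x = x and y = "y - 1" and i = i and j = j] ord less.prems 2 Lx Ly by force
      next
        case 3
        then have "above (dist (u (i - 1)) (u j)) < above (dist (u i) (u j))"
          using ord less.prems by (intro dec long) auto
        then show False
          using less.hyps [where x = x and y = y and i = "i - 1" and j = j] ord less.prems 3 Lx Ly by force
      next
        case 4
        then have "above (dist (u i) (u (j + 1))) < above (dist (u i) (u j))"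
          using ord less.prems by (intro dec long) auto
        then show False
          using less.hyps [where x = x and y = y and i = i and j = "j + 1"] ord less.prems 4 Lx Ly by force
      qed
    qed
  qed
  then show ?thesis using assms by (simp add: above_def)
qed

lemma finite_distances: "finite V \<Longrightarrow> finite (distances V)"
proof -
  assume "finite V"
  then have "finite ((\<lambda>(u, v). dist u v) ` (V \<times> V))" by simp
  then show ?thesis by (rule finite_subset [rotated]) (auto simp: distances_def)
qed

text \<open>The enumeration starts at \<open>b\<close> and reaches \<open>a\<close> at index \<open>m\<close>, so the indices beyond \<open>m\<close> are the few
  vertices on the short side. The covering block consists of these and the indices within about \<open>2k\<close> of
  0 or of \<open>m\<close>; any long chord avoiding it would be disjoint from \<open>ab\<close> with wide gaps on both sides.\<close>

lemma small_cover_of_long_pairs: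
  assumes V: "finite V" "convex_position V" "a \<in> V" "b \<in> V" "a \<noteq> b"
    and side: "card {x \<in> V. 0 < orient b a x} \<le> l"
    and d: "d \<le> dist a b" and k: "card {t \<in> distances V. d \<le> t} \<le> k"
  shows "\<exists>S \<subseteq> V. card S \<le> 4 * k + l \<and> (\<forall>p\<in>V. \<forall>q\<in>V. p \<noteq> q \<and> d \<le> dist p q \<longrightarrow> p \<in> S \<or> q \<in> S)"
proof -
  obtain u where u: "bij_betw u {..<card V} V" "u 0 = b" "convex_chain u (card V)"
    using convex_position_enumeration V by metis
  then have inj: "inj_on u {..<card V}" and img: "u ` {..<card V} = V" by (auto simp: bij_betw_def)
  obtain m where m: "m < card V" "u m = a" using img V(3) by (metis imageE lessThan_iff)
  then have "0 < m" using u(2) V(5) by (metis gr0I)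
  \<comment> \<open>Truncated subtraction lets the second interval start at 0 if \<open>m + 1 < 2 * k\<close>.\<close>
  define I where "I = {..<2 * k} \<inter> {..<card V} \<union> {m + 1 - 2 * k..<card V}"
  have "u ` {m + 1..<card V} \<subseteq> {x \<in> V. 0 < orient b a x}"
    using u(2,3) m \<open>0 < m\<close> img by (auto simp: convex_chain_def)
  then have "card (u ` {m + 1..<card V}) \<le> card {x \<in> V. 0 < orient b a x}"
    using V(1) by (intro card_mono) auto
  moreover have "inj_on u {m + 1..<card V}"
    using inj by (rule inj_on_subset) auto
  ultimately have few: "card V - (m + 1) \<le> l"
    using side by (simp add: card_image)
  have "card I \<le> card ({..<2 * k} \<inter> {..<card V}) + card {m + 1 - 2 * k..<card V}"
    unfolding I_def by (rule card_Un_le)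
  moreover have "card ({..<2 * k} \<inter> {..<card V}) \<le> card {..<2 * k}" by (intro card_mono) auto
  ultimately have "card I \<le> 4 * k + l" using few m by simp
  then have "card (u ` I) \<le> 4 * k + l"
    using card_image_le [of I u] by (simp add: I_def)
  moreover have "u ` I \<subseteq> V" using img by (auto simp: I_def)
  moreover have cover: "u i \<in> u ` I \<or> u j \<in> u ` I" if ij: "i < j" "j < card V" "d \<le> dist (u i) (u j)" for i j
  proof (rule ccontr)
    assume "\<not> ?thesis"
    then have "2 * k \<le> i" "j < m + 1 - 2 * k" using ij by (force simp: I_def)+
    define K where "K = {t \<in> distances V. d \<le> t}"
    have K: "finite K" using finite_distances [OF V(1)] by (simp add: K_def)
    have long: "dist (u p) (u q) \<in> K" if "p < q" "q < card V" "d \<le> dist (u p) (u q)" for p q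
    proof -
      have "u p \<noteq> u q" using inj that by (auto simp: inj_on_def)
      moreover have "u p \<in> V" "u q \<in> V" using img that by auto
      ultimately show ?thesis using that by (auto simp: K_def distances_def)
    qed
    have above: "card {s \<in> K. t < s} < k" if "t \<in> K" for t
    proof -
      have "card {s \<in> K. t < s} < card K" using K that by (intro psubset_card_mono) auto
      then show ?thesis using k by (simp add: K_def)
    qed
    have d0: "d \<le> dist (u 0) (u m)" using d m u(2) by (simp add: dist_commute)
    have "card {s \<in> K. dist (u 0) (u m) < s} < k" "card {s \<in> K. dist (u i) (u j) < s} < k"
      using above long ij d0 m \<open>0 < m\<close> by auto
    then have "m - j < 2 * k"
      using disjoint_long_chords_close [OF u(3) K long \<open>i < j\<close> m(1) d0 ij(3)] \<open>2 * k \<le> i\<close> by linarith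
    then show False using \<open>j < m + 1 - 2 * k\<close> by simp
  qed
  moreover have "p \<in> u ` I \<or> q \<in> u ` I" if pq: "p \<in> V" "q \<in> V" "p \<noteq> q" "d \<le> dist p q" for p q
  proof -
    have "p \<in> u ` {..<card V}" "q \<in> u ` {..<card V}"
      using pq img by simp_all
    then obtain i j where ij: "i < card V" "j < card V" "p = u i" "q = u j" by blast
    then have "i \<noteq> j" using pq(3) by auto
    then consider "i < j" | "j < i" by linarith
    then show ?thesis
    proof cases
      case 1
      then show ?thesis using cover [of i j] ij pq(4) by blast
    next
      case 2
      moreover have "d \<le> dist (u j) (u i)" using pq(4) ij by (simp add: dist_commute)
      ultimately show ?thesis using cover [of j i] ij by blast
    qed
  qed
  ultimately show ?thesis
    by (intro exI [of _ "u ` I"]) simp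
qed

section \<open>Counting long pairs\<close>

text \<open>Three common points of two circles would lie on a line orthogonal to \<open>pq\<close>, contrary to convex
  position.\<close>

lemma card_equidistant_le_2:
  assumes V: "finite V" "convex_position V" and "p \<noteq> q"
  shows "card {v \<in> V. dist v p = s \<and> dist v q = t} \<le> 2"
proof (rule ccontr)
  assume "\<not> ?thesis"
  then have "3 \<le> card {v \<in> V. dist v p = s \<and> dist v q = t}" by simp
  then obtain T where T: "T \<subseteq> {v \<in> V. dist v p = s \<and> dist v q = t}" "card T = 3"
    by (meson obtain_subset_with_card_n)
  then obtain x y z where xyz: "T = {x, y, z}" "x \<noteq> y" "y \<noteq> z" "x \<noteq> z"
    by (auto simp: card_3_iff)
  have perp: "(v - x) \<bullet> (q - p) = 0" if "v \<in> T" for v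
  proof -
    have "dist v p = dist x p" "dist v q = dist x q" using T xyz that by auto
    then have "(v - p) \<bullet> (v - p) = (x - p) \<bullet> (x - p)" "(v - q) \<bullet> (v - q) = (x - q) \<bullet> (x - q)"
      by (simp_all add: dist_norm norm_eq)
    then show ?thesis by (simp add: algebra_simps inner_commute)
  qed
  have yz: "(y - x) \<bullet> (q - p) = 0" "(z - x) \<bullet> (q - p) = 0"
    using perp xyz(1) by simp_all
  have "orient x y z * (q$1 - p$1) = 0"
    using yz unfolding orient_def inner_vec2 vector_minus_component by algebra
  moreover have "orient x y z * (q$2 - p$2) = 0"
    using yz unfolding orient_def inner_vec2 vector_minus_component by algebra
  moreover have "q$1 - p$1 \<noteq> 0 \<or> q$2 - p$2 \<noteq> 0"
    using \<open>p \<noteq> q\<close> vec2_eqI [of p q] by auto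
  ultimately have "orient x y z = 0" by auto
  then show False
    using no_three_collinear [OF V(2), of x y z] xyz T(1) by auto
qed

text \<open>\<open>W\<close> consists of the vertices with two long partners in \<open>S\<close>. A long pair lies within \<open>S\<close>, or joins \<open>S\<close>
  to \<open>W\<close>, or is determined by its end outside \<open>S \<union> W\<close>, whose partner in \<open>S\<close> is unique. The summands of the
  bound come from the third, the first and the second kind of pair.\<close>

lemma card_long_pairs_le:
  assumes V: "finite V" "convex_position V" and S: "S \<subseteq> V" "card S \<le> s"
    and cover: "\<forall>p\<in>V. \<forall>q\<in>V. p \<noteq> q \<and> d \<le> dist p q \<longrightarrow> p \<in> S \<or> q \<in> S"
    and k: "card {t \<in> distances V. d \<le> t} \<le> k"
  shows "card {{p, q} | p q. p \<in> V \<and> q \<in> V \<and> p \<noteq> q \<and> d \<le> dist p q}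
         \<le> card V + (s * s + s * (s * s * (k * k * 2)))"
proof -
  define K where "K = {t \<in> distances V. d \<le> t}"
  have K: "finite K" "card K \<le> k" using k finite_distances [OF V(1)] by (auto simp: K_def)
  have inK: "dist p q \<in> K" if "p \<in> V" "q \<in> V" "p \<noteq> q" "d \<le> dist p q" for p q
    using that by (auto simp: K_def distances_def)
  have finS: "finite S" using S V finite_subset by auto
  define nb where "nb v = {p \<in> S. p \<noteq> v \<and> d \<le> dist v p}" for v
  define W where "W = {v \<in> V. \<exists>p\<in>nb v. \<exists>q\<in>nb v. p \<noteq> q}"
  define Q where "Q = {(p, q). p \<in> S \<and> q \<in> S \<and> p \<noteq> q}"
  have Q: "finite Q" "card Q \<le> s * s"
  proof -
    have "Q \<subseteq> S \<times> S" by (auto simp: Q_def)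
    moreover have "finite (S \<times> S)" using finS by simp
    ultimately have "card Q \<le> card (S \<times> S)" "finite Q"
      by (auto intro: card_mono finite_subset)
    then show "finite Q" "card Q \<le> s * s"
      using mult_le_mono [OF S(2) S(2)] by (simp_all add: card_cartesian_product)
  qed
  have W: "card W \<le> s * s * (k * k * 2)"
  proof -
    \<comment> \<open>A point of \<open>W\<close> lies on two circles with distinct centres in \<open>S\<close> and radii in \<open>K\<close>.\<close>
    let ?F = "\<lambda>(p, q). \<Union>(a, b)\<in>K \<times> K. {v \<in> V. dist v p = a \<and> dist v q = b}"
    have "card (?F e) \<le> k * k * 2" if "e \<in> Q" for e
    proof -
      from \<open>e \<in> Q\<close> obtain p q where e: "e = (p, q)" "p \<noteq> q" by (auto simp: Q_def)
      have "card (?F e) \<le> (\<Sum>(a, b)\<in>K \<times> K. card {v \<in> V. dist v p = a \<and> dist v q = b})"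
        using card_UN_le [of "K \<times> K" "\<lambda>(a, b). {v \<in> V. dist v p = a \<and> dist v q = b}"] K(1) e(1)
        by (simp add: case_prod_beta)
      also have "\<dots> \<le> card (K \<times> K) * 2"
        using sum_mono [of "K \<times> K" "\<lambda>(a, b). card {v \<in> V. dist v p = a \<and> dist v q = b}" "\<lambda>_. 2"]
          card_equidistant_le_2 [OF V e(2)] by auto
      also have "\<dots> \<le> k * k * 2"
        using mult_le_mono [OF K(2) K(2)] by (simp add: card_cartesian_product)
      finally show ?thesis .
    qed
    then have "(\<Sum>e\<in>Q. card (?F e)) \<le> card Q * (k * k * 2)"
      by (intro sum_bounded_above [where K = "k * k * 2", simplified]) auto
    then have "card (\<Union>e\<in>Q. ?F e) \<le> card Q * (k * k * 2)"
      using card_UN_le [OF Q(1), of ?F] by linarith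
    also have "\<dots> \<le> s * s * (k * k * 2)" using Q(2) by simp
    finally have "card (\<Union>e\<in>Q. ?F e) \<le> s * s * (k * k * 2)" .
    moreover have "W \<subseteq> (\<Union>e\<in>Q. ?F e)"
    proof
      fix v assume "v \<in> W"
      then obtain p q where pq: "v \<in> V" "p \<in> nb v" "q \<in> nb v" "p \<noteq> q" by (auto simp: W_def)
      then have "(p, q) \<in> Q" "dist v p \<in> K" "dist v q \<in> K"
        using S(1) inK by (auto simp: nb_def Q_def)
      then show "v \<in> (\<Union>e\<in>Q. ?F e)"
        using pq(1) by force
    qed
    moreover have "finite (\<Union>e\<in>Q. ?F e)"
      by (rule finite_subset [OF _ V(1)]) auto
    ultimately show ?thesis by (meson card_mono le_trans)
  qed
  define E where "E = {{p, q} | p q. p \<in> V \<and> q \<in> V \<and> p \<noteq> q \<and> d \<le> dist p q}"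
  define E1 where "E1 = (\<lambda>(p, q). {p, q}) ` (S \<times> S)"
  define E2 where "E2 = (\<lambda>(p, q). {p, q}) ` (S \<times> W)"
  \<comment> \<open>If \<open>v\<close> has exactly one long partner in \<open>S\<close>, the choice below is that partner; for the other \<open>v\<close> the pair
    is junk, which does not hurt an upper bound.\<close>
  define E3 where "E3 = (\<lambda>v. {v, (SOME p. p \<in> nb v)}) ` V"
  have fW: "finite W" using V(1) by (simp add: W_def)
  have touch: "{p, v} \<in> E1 \<union> E2 \<union> E3" if "p \<in> S" "v \<in> V" "p \<noteq> v" "d \<le> dist p v" for p v
  proof (cases "v \<in> W")
    case True
    then have "{p, v} \<in> E2" using that by (force simp: E2_def)
    then show ?thesis by simp
  next
    case False
    have p: "p \<in> nb v" using that by (simp add: nb_def dist_commute)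
    then have "(SOME q. q \<in> nb v) = p"
      using False that by (intro some_equality) (auto simp: W_def)
    then have "{v, p} \<in> E3" using that by (force simp: E3_def)
    then show ?thesis by (simp add: insert_commute)
  qed
  have "E \<subseteq> E1 \<union> E2 \<union> E3"
  proof
    fix e assume "e \<in> E"
    then obtain p q where e: "e = {p, q}" "p \<in> V" "q \<in> V" "p \<noteq> q" "d \<le> dist p q"
      by (auto simp: E_def)
    then have "p \<in> S \<or> q \<in> S" using cover by blast
    then show "e \<in> E1 \<union> E2 \<union> E3"
      using touch [of p q] touch [of q p] e by (auto simp: insert_commute dist_commute)
  qed
  then have "card E \<le> card (E1 \<union> E2 \<union> E3)"
    using finS fW V(1) by (intro card_mono) (auto simp: E1_def E2_def E3_def)
  also have "\<dots> \<le> card E1 + card E2 + card E3"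
    using card_Un_le [of "E1 \<union> E2" E3] card_Un_le [of E1 E2] by linarith
  also have "card E1 \<le> s * s"
    using card_image_le [of "S \<times> S" "\<lambda>(p, q). {p, q}"] mult_le_mono [OF S(2) S(2)] finS
    by (simp add: E1_def card_cartesian_product)
  also have "card E2 \<le> s * (s * s * (k * k * 2))"
    using card_image_le [of "S \<times> W" "\<lambda>(p, q). {p, q}"] mult_le_mono [OF S(2) W] finS fW
    by (simp add: E2_def card_cartesian_product)
  also have "card E3 \<le> card V"
    using V(1) by (simp add: E3_def card_image_le)
  finally show ?thesis by (simp add: E_def)
qed

text \<open>In the decreasing list of distances, those not below entry \<open>k\<close> are the first \<open>k\<close> entries.\<close>

lemma card_distances_ge_nth:
  assumes "finite V" "1 \<le> k" "k \<le> card (distances V)"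
  shows "card {t \<in> distances V. nth_distance V k \<le> t} \<le> k"
proof -
  define xs where "xs = rev (sorted_list_of_set (distances V))"
  have xs: "set xs = distances V" "length xs = card (distances V)" "sorted_wrt (>) xs"
    using finite_distances [OF assms(1)] by (auto simp: xs_def sorted_wrt_rev strict_sorted_list_of_set)
  have "{t \<in> distances V. nth_distance V k \<le> t} \<subseteq> (!) xs ` {..<k}"
  proof
    fix t assume "t \<in> {t \<in> distances V. nth_distance V k \<le> t}"
    then have "t \<in> set xs" and "xs ! (k - 1) \<le> t"
      using xs(1) by (auto simp: nth_distance_def xs_def)
    then obtain j where j: "j < length xs" "t = xs ! j" and le: "xs ! (k - 1) \<le> xs ! j"
      unfolding in_set_conv_nth by blast
    have "j < k"
    proof (rule ccontr)
      assume "\<not> j < k"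
      then have "xs ! (k - 1) > xs ! j"
        using sorted_wrt_nth_less [OF xs(3), of "k - 1" j] j(1) assms(2) by simp
      then show False using le by simp
    qed
    then show "t \<in> (!) xs ` {..<k}" using j(2) by simp
  qed
  then have "card {t \<in> distances V. nth_distance V k \<le> t} \<le> card ((!) xs ` {..<k})"
    by (intro card_mono) auto
  also have "\<dots> \<le> k" using card_image_le [of "{..<k}" "(!) xs"] by simp
  finally show ?thesis .
qed

lemma sum_distance_mult_le:
  fixes V :: "'a::metric_space set"
  assumes "finite V" "1 \<le> k" "k \<le> card (distances V)"
  shows "(\<Sum>i=1..k. distance_mult V i)
         \<le> card {{p, q} | p q. p \<in> V \<and> q \<in> V \<and> p \<noteq> q \<and> nth_distance V k \<le> dist p q}"
proof -
  define xs where "xs = rev (sorted_list_of_set (distances V))"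
  have xs: "length xs = card (distances V)" "sorted_wrt (>) xs"
    using finite_distances [OF assms(1)] by (auto simp: xs_def sorted_wrt_rev strict_sorted_list_of_set)
  have less: "nth_distance V j < nth_distance V i" if "1 \<le> i" "i < j" "j \<le> k" for i j
    using sorted_wrt_nth_less [OF xs(2), of "i - 1" "j - 1"] that xs(1) assms(3)
    by (simp add: nth_distance_def xs_def)
  define E where "E i = {{u, v} | u v. u \<in> V \<and> v \<in> V \<and> u \<noteq> v \<and> dist u v = nth_distance V i}" for i
  have fin: "finite {{p, q} | p q. p \<in> V \<and> q \<in> V \<and> R p q}" for R
    by (rule finite_subset [of _ "(\<lambda>(p, q). {p, q}) ` (V \<times> V)"]) (use assms(1) in auto)
  have disj: "E i \<inter> E j = {}" if "i \<in> {1..k}" "j \<in> {1..k}" "i \<noteq> j" for i j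
  proof -
    have "nth_distance V i \<noteq> nth_distance V j"
      using less [of i j] less [of j i] that by (cases "i < j") auto
    then show ?thesis by (auto simp: E_def doubleton_eq_iff dist_commute)
  qed
  have "(\<Sum>i=1..k. distance_mult V i) = (\<Sum>i=1..k. card (E i))"
    by (simp add: distance_mult_def E_def)
  also have "\<dots> = card (\<Union>i\<in>{1..k}. E i)"
    using disj by (intro card_UN_disjoint [symmetric]) (auto simp: E_def intro: fin)
  also have "\<dots> \<le> card {{p, q} | p q. p \<in> V \<and> q \<in> V \<and> p \<noteq> q \<and> nth_distance V k \<le> dist p q}"
  proof (intro card_mono fin subsetI)
    fix e assume "e \<in> (\<Union>i\<in>{1..k}. E i)"
    then obtain i u v where i: "1 \<le> i" "i \<le> k" and e: "e = {u, v}" "u \<in> V" "v \<in> V" "u \<noteq> v"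
      "dist u v = nth_distance V i" by (auto simp: E_def)
    have "nth_distance V k \<le> nth_distance V i"
      using less [of i k] i by (cases "i = k") auto
    then have "nth_distance V k \<le> dist u v" using e(5) by simp
    then show "e \<in> {{p, q} | p q. p \<in> V \<and> q \<in> V \<and> p \<noteq> q \<and> nth_distance V k \<le> dist p q}"
      using e(2-4) unfolding e(1) by blast
  qed
  finally show ?thesis .
qed

section \<open>The bound\<close>

theorem lemma1p5:
  fixes k l :: nat
  assumes "k \<ge> 1"
  shows "\<exists>C::nat. \<forall>(n::nat) (P :: (real ^ 2) set) a b.
           convex_polygon P \<and> card (polygon_vertices P) = n \<and>
           k \<le> card (distances (polygon_vertices P)) \<and>
           a \<in> polygon_vertices P \<and> b \<in> polygon_vertices P \<and> a \<noteq> b \<and>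
           at_most_between P l a b \<and>
           dist a b \<ge> nth_distance (polygon_vertices P) k
           \<longrightarrow> (\<Sum>i=1..k. distance_mult (polygon_vertices P) i) \<le> n + C"
proof -
  let ?s = "4 * k + l"
  let ?C = "?s * ?s + ?s * (?s * ?s * (k * k * 2))"
  have "(\<Sum>i=1..k. distance_mult V i) \<le> card V + ?C"
    if P: "convex_polygon P" and V_def: "V = polygon_vertices P" and k: "k \<le> card (distances V)"
      and ab: "a \<in> V" "b \<in> V" "a \<noteq> b" and l: "at_most_between P l a b"
      and d: "nth_distance V k \<le> dist a b" for P V a b
  proof -
    have "convex P" "polyhedron P"
      using P by (simp_all add: convex_polygon_def polytope_imp_convex polytope_imp_polyhedron)
    then have V: "finite V" "convex_position V"
      by (simp_all add: V_def polygon_vertices_def finite_polyhedron_extreme_points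
          convex_position_extreme_points)
    note K = card_distances_ge_nth [OF V(1) assms k]
    note cover = small_cover_of_long_pairs [OF V]
    have "card {x \<in> V. 0 < orient a b x} \<le> l \<or> card {x \<in> V. 0 < orient b a x} \<le> l"
      using at_most_between_imp_few_on_side [OF P] ab l by (simp add: V_def orient_flip [of b a])
    then obtain S where S: "S \<subseteq> V" "card S \<le> ?s"
      "\<forall>p\<in>V. \<forall>q\<in>V. p \<noteq> q \<and> nth_distance V k \<le> dist p q \<longrightarrow> p \<in> S \<or> q \<in> S"
    proof
      assume "card {x \<in> V. 0 < orient a b x} \<le> l"
      from cover [OF ab(2,1) ab(3) [symmetric] this _ K] d show thesis
        using that by (auto simp: dist_commute)
    next
      assume "card {x \<in> V. 0 < orient b a x} \<le> l"
      from cover [OF ab this d K] show thesis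
        using that by auto
    qed
    show ?thesis
      using sum_distance_mult_le [OF V(1) assms k] card_long_pairs_le [OF V S K] by linarith
  qed
  then show ?thesis by (intro exI [of _ ?C]) blast
qed

end
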